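(* Let $X$ be a compact metric space with metric $d$, let $T:X\to X$ be a continuous map, and let $\mu$ be an ergodic invariant Borel probability measure of $T$ with positive expansion exponent, $E_\mu(T)>0$, and positive upper capacity, $\overline{\dim}_B(\mu)>0$. Then $h_\mu(T)>0$.
   Context: A Borel probability measure of $X$ is a $\sigma$-additive measure $\mu$ on the Borel $\sigma$-algebra of $X$ with $\mu(X)=1$. It is invariant (for $T$) if $\mu(T^{-1}(B))=\mu(B)$ for all Borel sets $B\subset X$, and ergodic for $T$ if $\mu(A)\in\{0,1\}$ for all Borel sets $A\subset X$ with $T^{-1}(A)=A$. $B(x,\epsilon)$ denotes the open ball of radius $\epsilon$ centered at $x$. Expansion exponent of $\mu$ with respect to $T$: $$E_\mu(T)=\sup\{\lambda\in\mathbb{R}\mid \exists\,\epsilon>0 \text{ such that } \mu(\{y\in B(x,\epsilon)\mid d(T(x),T(y))<e^\lambda d(x,y)\})=0 \text{ for all } x\in X\},$$ with the convention $\sup\emptyset=-\infty$ (the value lies in $[-\infty,+\infty]$). Upper capacity of $\mu$: $$\overline{\dim}_B(\mu)=\lim_{\delta\to0}\limsup_{\beta\to0}\frac{\log N_\mu(X,\beta,\delta)}{-\log\beta},$$ where $N_\mu(X,\beta,\delta)$ is the minimal number of open balls of radius $\beta$ needed to cover a subset of $X$ of $\mu$-measure bigger than or equal to $1-\delta$ (here $\delta,\beta>0$ tend to $0$ from above). Kolmogorov–Sinai entropy of an invariant measure $\mu$: $$h_\mu(T)=\sup_\alpha\lim_{n\to\infty}\frac1n H_\mu\Big(\bigvee_{i=0}^{n-1}T^{-i}(\alpha)\Big),$$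 where the supremum is over the finite partitions $\alpha$ of $X$ into pairwise disjoint Borel sets with union $X$; $T^{-i}(\alpha)=\{T^{-i}(A)\mid A\in\alpha\}$; $\bigvee_{i=0}^{n-1}\alpha_i=\{A_0\cap\cdots\cap A_{n-1}\mid A_i\in\alpha_i,\ i=0,\dots,n-1\}$; and $H_\mu(\alpha)=-\sum_{A\in\alpha}\mu(A)\log\mu(A)$ with $0\cdot\log 0=0$. *)

theory Defs
  imports "HOL-Probability.Probability"
begin

definition borel_probability :: "'a::metric_space measure \<Rightarrow> bool" where
  "borel_probability \<mu> \<longleftrightarrow> sets \<mu> = sets borel \<and> prob_space \<mu>"

definition invariant_measure :: "('a::metric_space \<Rightarrow> 'a) \<Rightarrow> 'a measure \<Rightarrow> bool" where
  "invariant_measure T \<mu> \<longleftrightarrow> (\<forall>B\<in>sets borel. measure \<mu> (T -` B) = measure \<mu> B)"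

definition ergodic_measure :: "('a::metric_space \<Rightarrow> 'a) \<Rightarrow> 'a measure \<Rightarrow> bool" where
  "ergodic_measure T \<mu> \<longleftrightarrow> (\<forall>A\<in>sets borel. T -` A = A \<longrightarrow> measure \<mu> A \<in> {0, 1})"

text \<open>Suprema are taken in the extended reals, so that the supremum of the empty set is
  \<open>-\<infinity>\<close>.  For continuous \<open>T\<close> the sets measured below are Borel, so no junk value of
  \<^const>\<open>measure\<close> is involved.\<close>

definition expansion_exponent :: "'a::metric_space measure \<Rightarrow> ('a \<Rightarrow> 'a) \<Rightarrow> ereal" where
  "expansion_exponent \<mu> T =
     Sup (ereal ` {a::real. \<exists>\<epsilon>>0. \<forall>x.
       measure \<mu> {y \<in> ball x \<epsilon>. dist (T x) (T y) < exp a * dist x y} = 0})"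

definition covering_number :: "'a::metric_space measure \<Rightarrow> real \<Rightarrow> real \<Rightarrow> nat" where
  "covering_number \<mu> \<beta> \<delta> =
     (LEAST n. \<exists>C A. finite C \<and> card C = n \<and> A \<in> sets \<mu> \<and> measure \<mu> A \<ge> 1 - \<delta> \<and>
        A \<subseteq> (\<Union>c\<in>C. ball c \<beta>))"

text \<open>The covering number is antimonotone in \<open>\<delta>\<close>, so the limit as \<open>\<delta>\<close> tends to \<open>0\<close> exists
  in the extended reals.\<close>

definition upper_capacity :: "'a::metric_space measure \<Rightarrow> ereal" where
  "upper_capacity \<mu> =
     Lim (at_right 0) (\<lambda>\<delta>::real.
       Limsup (at_right 0) (\<lambda>\<beta>::real. ereal (ln (real (covering_number \<mu> \<beta> \<delta>)) / (- ln \<beta>))))"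

definition finite_borel_partition :: "'a::topological_space set set \<Rightarrow> bool" where
  "finite_borel_partition \<alpha> \<longleftrightarrow>
     finite \<alpha> \<and> \<alpha> \<subseteq> sets borel \<and> disjoint \<alpha> \<and> \<Union>\<alpha> = UNIV"

text \<open>No special convention is needed for \<open>0 \<cdot> log 0 = 0\<close>, because \<open>ln\<close> is total.\<close>

definition partition_entropy :: "'a measure \<Rightarrow> 'a set set \<Rightarrow> real" where
  "partition_entropy \<mu> \<alpha> = - (\<Sum>A\<in>\<alpha>. measure \<mu> A * ln (measure \<mu> A))"

definition preimage_partition :: "('a \<Rightarrow> 'a) \<Rightarrow> nat \<Rightarrow> 'a set set \<Rightarrow> 'a set set" where
  "preimage_partition T i \<alpha> = {(T ^^ i) -` A | A. A \<in> \<alpha>}"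

definition partition_join :: "nat \<Rightarrow> (nat \<Rightarrow> 'a set set) \<Rightarrow> 'a set set" where
  "partition_join n \<alpha> = {(\<Inter>i<n. A i) | A. \<forall>i<n. A i \<in> \<alpha> i}"

text \<open>For invariant \<open>\<mu>\<close> the limit exists by subadditivity.\<close>

definition ks_entropy :: "'a::metric_space measure \<Rightarrow> ('a \<Rightarrow> 'a) \<Rightarrow> ereal" where
  "ks_entropy \<mu> T =
     (SUP \<alpha>\<in>{\<alpha>. finite_borel_partition \<alpha>}.
        ereal (lim (\<lambda>n. partition_entropy \<mu> (partition_join n (\<lambda>i. preimage_partition T i \<alpha>)) / real n)))"

end

theory Submission
  imports Defs
begin

text \<open>
  The argument is by contraposition: if the entropy vanishes, so does the upper capacity.

  Positivity of the expansion exponent gives \<open>a > 0\<close> and \<open>\<epsilon> > 0\<close> such that for every \<open>x\<close> almost all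
  \<open>y\<close> in the ball of radius \<open>\<epsilon>\<close> around \<open>x\<close> satisfy \<open>d (T x) (T y) \<ge> exp a * d x y\<close>.  The exceptional
  set of \<open>x\<close> is open, because \<open>T\<close> is continuous and the inequality defining it is strict; being
  null, it misses the support of the measure.  Hence \<open>T\<close> really expands distances below \<open>\<epsilon>\<close> from
  points of the support, and the support has full measure (\<open>ex_full_measure_support\<close>).

  Fix a finite partition \<open>\<alpha>\<close> whose members contain only points less than \<open>\<epsilon>\<close> apart, and let \<open>\<alpha>\<^sub>n\<close> be
  the join of its first \<open>n\<close> preimages.  Two points in one atom of \<open>\<alpha>\<^sub>n\<close> stay \<open>\<epsilon>\<close>-close for \<open>n\<close> steps, so, if the orbit of one
  of them stays in the support, their initial distance is less than \<open>\<epsilon> * exp (- a * (n - 1))\<close>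
  (\<open>expansion_along_orbit\<close>).  An atom of \<open>\<alpha>\<^sub>n\<close> therefore fits, up to a null set, into a single ball of
  that radius.  If \<open>H(\<alpha>\<^sub>n) / n\<close> tends to \<open>0\<close>, then for every \<open>\<eta> > 0\<close> the atoms of measure at least
  \<open>exp (- n * \<eta>)\<close>, of which there are at most \<open>exp (n * \<eta>)\<close>, carry almost all of the mass
  (\<open>large_atoms\<close>).  Together this bounds the covering number at scale \<open>\<epsilon> * exp (- a * (n - 1))\<close> by
  \<open>exp (n * \<eta>)\<close> (\<open>covering_number_le\<close>), so the upper capacity is at most a constant times \<open>\<eta>\<close>
  (\<open>upper_capacity_eq_0\<close>).

  That the limit defining the entropy of \<open>T\<close> relative to \<open>\<alpha>\<close> exists follows from subadditivity of
  \<open>n \<mapsto> H(\<alpha>\<^sub>n)\<close> and Fekete's lemma.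
\<close>

section \<open>Fekete's lemma\<close>

text \<open>Writing \<open>n = q * m + r\<close> with \<open>r < m\<close> gives \<open>u n \<le> q * u m + u r\<close>, so \<open>u n / n\<close> exceeds \<open>u m / m\<close> by
  at most a constant over \<open>n\<close>; the limit is the infimum of the quotients.\<close>

lemma convergent_subadditive_quotient:
  fixes u :: "nat \<Rightarrow> real"
  assumes sub: "\<And>m n. u (m + n) \<le> u m + u n" and nonneg: "\<And>n. 0 \<le> u n"
  shows "convergent (\<lambda>n. u n / real n)"
proof -
  have mult: "u (q * m + r) \<le> real q * u m + u r" for q m r
  proof (induction q)
    case (Suc q)
    have "u (Suc q * m + r) \<le> u m + u (q * m + r)"
      using sub[of m "q * m + r"] by (simp add: add.assoc)
    with Suc show ?case by (simp add: algebra_simps)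
  qed simp
  define L where "L = (INF n\<in>{1..}. u n / real n)"
  have bdd: "bdd_below ((\<lambda>n. u n / real n) ` {1..})"
    by (rule bdd_belowI[of _ 0]) (auto simp: nonneg)
  have lower: "L \<le> u n / real n" if "n \<ge> 1" for n
    unfolding L_def using that by (intro cINF_lower bdd) auto
  have "(\<lambda>n. u n / real n) \<longlonglongrightarrow> L"
  proof (rule order_tendstoI)
    fix b assume "b < L"
    show "eventually (\<lambda>n. b < u n / real n) sequentially"
      using eventually_ge_at_top[of 1] by eventually_elim (use lower \<open>b < L\<close> in fastforce)
  next
    fix b assume "L < b"
    then obtain m where m: "m \<ge> 1" "u m / real m < b"
      unfolding L_def using cInf_lessD[of "(\<lambda>n. u n / real n) ` {1..}" b] by auto
    define M where "M = (\<Sum>r<m. u r)"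
    have M: "u r \<le> M" if "r < m" for r
      unfolding M_def using that nonneg by (intro member_le_sum) auto
    have "(\<lambda>n. u m / real m + M / real n) \<longlonglongrightarrow> u m / real m + 0"
      by (intro tendsto_intros lim_const_over_n)
    then have "eventually (\<lambda>n. u m / real m + M / real n < b) sequentially"
      using m by (intro order_tendstoD) auto
    then show "eventually (\<lambda>n. u n / real n < b) sequentially"
      using eventually_ge_at_top[of 1]
    proof eventually_elim
      case (elim n)
      have "u n \<le> real (n div m) * u m + u (n mod m)"
        using mult[of "n div m" m "n mod m"] by simp
      also have "\<dots> \<le> real (n div m) * u m + M"
        using M[of "n mod m"] m by simp
      also have "real (n div m) * u m \<le> real n / real m * u m"
      proof (intro mult_right_mono nonneg)
        have "real (n div m * m) \<le> real n" by (simp only: of_nat_le_iff div_times_less_eq_dividend)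
        then show "real (n div m) \<le> real n / real m" using m by (simp add: field_simps)
      qed
      finally have "u n / real n \<le> (real n / real m * u m + M) / real n"
        by (simp add: divide_right_mono)
      also have "\<dots> = u m / real m + M / real n"
        using elim by (simp add: field_simps)
      finally show ?case using elim by simp
    qed
  qed
  then show ?thesis by (rule convergentI)
qed

section \<open>Entropy of finite partitions\<close>

lemma finite_borel_partition_vimage:
  assumes "finite_borel_partition P" "f \<in> borel_measurable borel"
  shows "finite_borel_partition ((-`) f ` P)"
  unfolding finite_borel_partition_def
proof (intro conjI)
  show "(-`) f ` P \<subseteq> sets borel"
    using assms(1) measurable_sets_borel[OF assms(2)]
    by (auto simp: finite_borel_partition_def)
  show "disjoint ((-`) f ` P)"
    unfolding disjoint_def
  proof clarify
    fix A B assume "A \<in> P" "B \<in> P" "f -` A \<noteq> f -` B"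
    then have "A \<inter> B = {}"
      using assms(1) unfolding finite_borel_partition_def disjoint_def by metis
    then show "f -` A \<inter> f -` B = {}" by blast
  qed
  have "\<Union>((-`) f ` P) = f -` \<Union>P" by blast
  then show "\<Union>((-`) f ` P) = UNIV"
    using assms(1) by (simp add: finite_borel_partition_def)
qed (use assms(1) in \<open>simp add: finite_borel_partition_def\<close>)

lemma finite_borel_partition_refinement:
  assumes "finite_borel_partition P" "finite_borel_partition Q"
  shows "finite_borel_partition ((\<lambda>(A, B). A \<inter> B) ` (P \<times> Q))"
proof -
  have "\<Union>((\<lambda>(A, B). A \<inter> B) ` (P \<times> Q)) = \<Union>P \<inter> \<Union>Q" by auto
  moreover have "disjoint ((\<lambda>(A, B). A \<inter> B) ` (P \<times> Q))"
    unfolding disjoint_def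
  proof clarify
    fix A B A' B' assume "A \<in> P" "B \<in> Q" "A' \<in> P" "B' \<in> Q" "A \<inter> B \<noteq> A' \<inter> B'"
    then have "A \<inter> A' = {} \<or> B \<inter> B' = {}"
      using assms unfolding finite_borel_partition_def disjoint_def by metis
    then show "(A \<inter> B) \<inter> (A' \<inter> B') = {}" by blast
  qed
  ultimately show ?thesis
    using assms unfolding finite_borel_partition_def by auto
qed

text \<open>Different members of a partition can have the same preimage only if that preimage is empty,
  so the identification made by forming a set of preimages loses no entropy.\<close>

lemma partition_entropy_vimage:
  assumes P: "finite_borel_partition P"
    and inv: "\<And>B. B \<in> sets borel \<Longrightarrow> measure \<mu> (f -` B) = measure \<mu> B"
  shows "partition_entropy \<mu> ((-`) f ` P) = partition_entropy \<mu> P"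
proof -
  have "(\<Sum>A\<in>(-`) f ` P. measure \<mu> A * ln (measure \<mu> A)) =
        sum ((\<lambda>A. measure \<mu> A * ln (measure \<mu> A)) \<circ> (-`) f) P"
  proof (rule sum.reindex_nontrivial)
    fix A B assume "A \<in> P" "B \<in> P" "A \<noteq> B" and eq: "f -` A = f -` B"
    then have "A \<inter> B = {}"
      using P unfolding finite_borel_partition_def disjoint_def by blast
    then have "f -` A = {}" using eq by blast
    then show "measure \<mu> (f -` A) * ln (measure \<mu> (f -` A)) = 0" by simp
  qed (use P in \<open>auto simp: finite_borel_partition_def\<close>)
  also have "\<dots> = (\<Sum>A\<in>P. measure \<mu> A * ln (measure \<mu> A))"
    using P inv by (intro sum.cong) (auto simp: finite_borel_partition_def)
  finally show ?thesis by (simp add: partition_entropy_def)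
qed

locale borel_prob_space = prob_space M for M :: "'a::topological_space measure" +
  assumes sets_M [simp]: "sets M = sets borel"
begin

lemma space_M [simp]: "space M = UNIV"
  by (metis sets_M sets_eq_imp_space_eq space_borel)

end

lemma borel_prob_spaceI: "borel_probability \<mu> \<Longrightarrow> borel_prob_space \<mu>"
  by (simp add: borel_probability_def borel_prob_space_def borel_prob_space_axioms_def)

lemma (in borel_prob_space) sum_prob_Int_partition:
  assumes P: "finite_borel_partition P" and A: "A \<in> sets borel"
  shows "(\<Sum>B\<in>P. prob (A \<inter> B)) = prob A"
proof -
  have "(\<Sum>B\<in>P. prob (A \<inter> B)) = prob (\<Union>B\<in>P. A \<inter> B)"
  proof (rule finite_measure_finite_Union[symmetric])
    show "disjoint_family_on (\<lambda>B. A \<inter> B) P"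
      using P unfolding finite_borel_partition_def disjoint_def disjoint_family_on_def by blast
  qed (use P A in \<open>auto simp: finite_borel_partition_def\<close>)
  also have "(\<Union>B\<in>P. A \<inter> B) = A"
    using P unfolding finite_borel_partition_def by blast
  finally show ?thesis .
qed

text \<open>This is the nonnegativity of mutual information.  It comes from \<open>ln x \<le> x - 1\<close> at
  \<open>x = \<mu>(A) \<mu>(B) / \<mu>(A \<inter> B)\<close>: multiplied by \<open>\<mu>(A \<inter> B)\<close>, the right-hand sides sum to \<open>1 - 1 = 0\<close>.\<close>

lemma (in borel_prob_space) partition_entropy_refinement_le:
  assumes P: "finite_borel_partition P" and Q: "finite_borel_partition Q"
  shows "partition_entropy M ((\<lambda>(A, B). A \<inter> B) ` (P \<times> Q))
    \<le> partition_entropy M P + partition_entropy M Q"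
proof -
  define g where "g A = prob A * ln (prob A)" for A
  have fin: "finite P" "finite Q" using P Q by (auto simp: finite_borel_partition_def)
  have meas: "A \<in> sets borel" if "A \<in> P \<union> Q" for A
    using that P Q by (auto simp: finite_borel_partition_def)
  have tot: "(\<Sum>A\<in>R. prob A) = 1" if "finite_borel_partition R" for R
    using sum_prob_Int_partition[OF that, of UNIV] prob_space
    by simp
  have "sum g ((\<lambda>(A, B). A \<inter> B) ` (P \<times> Q)) = sum (g \<circ> (\<lambda>(A, B). A \<inter> B)) (P \<times> Q)"
  proof (rule sum.reindex_nontrivial)
    fix x y assume "x \<in> P \<times> Q" "y \<in> P \<times> Q" "x \<noteq> y"
      and eq: "(case x of (A, B) \<Rightarrow> A \<inter> B) = (case y of (A, B) \<Rightarrow> A \<inter> B)"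
    then have "fst x \<inter> fst y = {} \<or> snd x \<inter> snd y = {}"
      using P Q unfolding finite_borel_partition_def disjoint_def
      by (metis mem_Times_iff prod_eqI)
    then have "(case x of (A, B) \<Rightarrow> A \<inter> B) = {}" using eq by (auto split: prod.splits)
    then show "g (case x of (A, B) \<Rightarrow> A \<inter> B) = 0" by (simp add: g_def)
  qed (use fin in auto)
  also have "\<dots> = (\<Sum>A\<in>P. \<Sum>B\<in>Q. g (A \<inter> B))"
    by (simp add: sum.cartesian_product split_def comp_def)
  also have "\<dots> \<ge> (\<Sum>A\<in>P. \<Sum>B\<in>Q. prob (A \<inter> B) * ln (prob A) + prob (A \<inter> B) * ln (prob B)
      + prob (A \<inter> B) - prob A * prob B)"
  proof (intro sum_mono)
    fix A B assume AB: "A \<in> P" "B \<in> Q"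
    show "prob (A \<inter> B) * ln (prob A) + prob (A \<inter> B) * ln (prob B)
      + prob (A \<inter> B) - prob A * prob B \<le> g (A \<inter> B)"
    proof (cases "prob (A \<inter> B) = 0")
      case True
      then show ?thesis by (simp add: g_def)
    next
      case False
      then have p: "prob (A \<inter> B) > 0" by (simp add: zero_less_measure_iff)
      moreover have "prob (A \<inter> B) \<le> prob A" "prob (A \<inter> B) \<le> prob B"
        using AB meas by (auto intro!: finite_measure_mono)
      ultimately have ab: "prob A > 0" "prob B > 0" by linarith+
      let ?x = "prob A * prob B / prob (A \<inter> B)"
      have "ln ?x \<le> ?x - 1"
        using p ab by (intro ln_le_minus_one) simp
      moreover have "ln ?x = ln (prob A) + ln (prob B) - ln (prob (A \<inter> B))"
        using p ab by (simp add: ln_div ln_mult)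
      ultimately have "prob (A \<inter> B) * (ln (prob A) + ln (prob B) - ln (prob (A \<inter> B)))
        \<le> prob (A \<inter> B) * (?x - 1)"
        using p by (intro mult_left_mono) auto
      also have "\<dots> = prob A * prob B - prob (A \<inter> B)"
        using p by (simp add: field_simps)
      finally show ?thesis by (simp add: g_def algebra_simps)
    qed
  qed
  also have "(\<Sum>A\<in>P. \<Sum>B\<in>Q. prob (A \<inter> B) * ln (prob A) + prob (A \<inter> B) * ln (prob B)
      + prob (A \<inter> B) - prob A * prob B) = sum g P + sum g Q"
  proof -
    have "(\<Sum>A\<in>P. \<Sum>B\<in>Q. prob (A \<inter> B) * ln (prob A)) = sum g P"
      unfolding g_def sum_distrib_right[symmetric]
      by (intro sum.cong refl) (simp add: sum_prob_Int_partition[OF Q] meas)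
    moreover have "(\<Sum>A\<in>P. \<Sum>B\<in>Q. prob (A \<inter> B) * ln (prob B)) = sum g Q"
      unfolding g_def
      by (subst sum.swap, unfold sum_distrib_right[symmetric], intro sum.cong refl, subst Int_commute)
         (simp add: sum_prob_Int_partition[OF P] meas)
    moreover have "(\<Sum>A\<in>P. \<Sum>B\<in>Q. prob (A \<inter> B)) = 1"
      using tot[OF P] by (simp add: sum_prob_Int_partition[OF Q] meas)
    moreover have "(\<Sum>A\<in>P. \<Sum>B\<in>Q. prob A * prob B) = 1"
      using tot[OF P] tot[OF Q] by (simp add: sum_distrib_left[symmetric])
    ultimately show ?thesis by (simp add: sum.distrib sum_subtractf)
  qed
  finally show ?thesis by (simp add: partition_entropy_def g_def)
qed

lemma (in borel_prob_space) partition_entropy_nonneg: "0 \<le> partition_entropy M P"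
proof -
  have "prob A * ln (prob A) \<le> 0" for A
    by (cases "prob A = 0")
       (auto intro!: mult_nonneg_nonpos simp: ln_le_zero_iff zero_less_measure_iff)
  then show ?thesis by (simp add: partition_entropy_def sum_nonpos)
qed

text \<open>The count holds because the atoms are disjoint and have total measure \<open>1\<close>.  The bound on the
  mass is Markov's inequality for the information function, equal to \<open>- ln \<mu>(A)\<close> on each atom \<open>A\<close>,
  whose integral is the entropy.\<close>

lemma (in borel_prob_space) large_atoms:
  fixes t :: real
  assumes P: "finite_borel_partition P" and t: "t > 0"
  defines "Q \<equiv> {A\<in>P. exp (- t) \<le> prob A}"
  shows "real (card Q) \<le> exp t"
    and "1 - partition_entropy M P / t \<le> prob (\<Union>Q)"
proof -
  have fin: "finite P" using P by (simp add: finite_borel_partition_def)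
  have meas: "A \<in> sets borel" if "A \<in> P" for A
    using that P by (auto simp: finite_borel_partition_def)
  have tot: "(\<Sum>A\<in>P. prob A) = 1"
    using sum_prob_Int_partition[OF P, of UNIV] prob_space by simp
  have QP: "Q \<subseteq> P" by (auto simp: Q_def)
  have "real (card Q) * exp (- t) = (\<Sum>A\<in>Q. exp (- t))" by simp
  also have "\<dots> \<le> (\<Sum>A\<in>Q. prob A)" by (intro sum_mono) (simp add: Q_def)
  also have "\<dots> \<le> (\<Sum>A\<in>P. prob A)" by (intro sum_mono2 fin QP) simp
  finally show "real (card Q) \<le> exp t"
    using tot by (simp add: exp_minus field_simps)
  have "t * (\<Sum>A\<in>P - Q. prob A) \<le> (\<Sum>A\<in>P - Q. - (prob A * ln (prob A)))"
    unfolding sum_distrib_left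
  proof (intro sum_mono)
    fix A assume A: "A \<in> P - Q"
    show "t * prob A \<le> - (prob A * ln (prob A))"
    proof (cases "prob A = 0")
      case False
      then have p: "prob A > 0" by (simp add: zero_less_measure_iff)
      have "prob A \<le> exp (- t)" using A by (auto simp: Q_def)
      then have "t \<le> - ln (prob A)"
        using p ln_mono[of "prob A" "exp (- t)"] by simp
      then have "prob A * t \<le> prob A * - ln (prob A)"
        using p by (intro mult_left_mono) auto
      then show ?thesis by (simp add: mult.commute)
    qed simp
  qed
  also have "\<dots> \<le> (\<Sum>A\<in>P. - (prob A * ln (prob A)))"
  proof (intro sum_mono2 fin)
    fix A
    show "0 \<le> - (prob A * ln (prob A))"
      using partition_entropy_nonneg[of "{A}"] by (simp add: partition_entropy_def)
  qed auto
  also have "\<dots> = partition_entropy M P"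
    by (simp add: partition_entropy_def sum_negf)
  finally have "(\<Sum>A\<in>P - Q. prob A) \<le> partition_entropy M P / t"
    using t by (simp add: field_simps)
  moreover have "(\<Sum>A\<in>P - Q. prob A) = 1 - (\<Sum>A\<in>Q. prob A)"
    using tot sum_diff[OF fin QP, of prob] by simp
  moreover have "(\<Sum>A\<in>Q. prob A) = prob (\<Union>Q)"
  proof -
    have "prob (\<Union>A\<in>Q. A) = (\<Sum>A\<in>Q. prob A)"
    proof (rule finite_measure_finite_Union)
      show "disjoint_family_on (\<lambda>A. A) Q"
        using P QP unfolding finite_borel_partition_def disjoint_def disjoint_family_on_def by blast
    qed (use QP fin meas finite_subset in auto)
    then show ?thesis by simp
  qed
  ultimately show "1 - partition_entropy M P / t \<le> prob (\<Union>Q)" by linarith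
qed

section \<open>Joins of iterated preimages\<close>

abbreviation dynamical_join :: "('a \<Rightarrow> 'a) \<Rightarrow> nat \<Rightarrow> 'a set set \<Rightarrow> 'a set set" where
  "dynamical_join T n \<alpha> \<equiv> partition_join n (\<lambda>i. preimage_partition T i \<alpha>)"

lemma dynamical_join_alt:
  "dynamical_join T n \<alpha> = {(\<Inter>i<n. (T ^^ i) -` B i) | B. \<forall>i<n. B i \<in> \<alpha>}"
proof (intro set_eqI iffI)
  fix S assume "S \<in> dynamical_join T n \<alpha>"
  then obtain A where S: "S = (\<Inter>i<n. A i)"
    and "\<forall>i<n. \<exists>B. A i = (T ^^ i) -` B \<and> B \<in> \<alpha>"
    by (auto simp: partition_join_def preimage_partition_def)
  then obtain B where "\<forall>i<n. A i = (T ^^ i) -` B i \<and> B i \<in> \<alpha>" by metis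
  with S show "S \<in> {(\<Inter>i<n. (T ^^ i) -` B i) | B. \<forall>i<n. B i \<in> \<alpha>}"
    by (intro CollectI exI[of _ B]) auto
next
  fix S assume "S \<in> {(\<Inter>i<n. (T ^^ i) -` B i) | B. \<forall>i<n. B i \<in> \<alpha>}"
  then obtain B where "S = (\<Inter>i<n. (T ^^ i) -` B i)" "\<forall>i<n. B i \<in> \<alpha>" by blast
  then show "S \<in> dynamical_join T n \<alpha>"
    unfolding partition_join_def preimage_partition_def
    by (intro CollectI exI[of _ "\<lambda>i. (T ^^ i) -` B i"]) blast
qed

lemma dynamical_join_add:
  "dynamical_join T (m + n) \<alpha> =
    (\<lambda>(A, B). A \<inter> B) ` (dynamical_join T m \<alpha> \<times> (-`) (T ^^ m) ` dynamical_join T n \<alpha>)"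
  (is "?L = ?R")
proof -
  have split: "(\<Inter>i<m + n. (T ^^ i) -` B i) =
      (\<Inter>i<m. (T ^^ i) -` B i) \<inter> (T ^^ m) -` (\<Inter>i<n. (T ^^ i) -` B (m + i))" for B
  proof -
    have "{..<m + n} = {..<m} \<union> (\<lambda>i. i + m) ` {..<n}"
    proof (intro equalityI subsetI)
      fix i assume "i \<in> {..<m + n}"
      then show "i \<in> {..<m} \<union> (\<lambda>i. i + m) ` {..<n}"
        by (cases "i < m") (auto intro!: image_eqI[of _ _ "i - m"])
    qed auto
    then have "(\<Inter>i<m + n. (T ^^ i) -` B i) =
        (\<Inter>i<m. (T ^^ i) -` B i) \<inter> (\<Inter>i<n. (T ^^ (i + m)) -` B (i + m))"
      by (simp add: INF_union image_image)
    then show ?thesis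
      by (simp add: funpow_add vimage_INT vimage_comp add.commute[of m])
  qed
  show ?thesis
  proof (intro set_eqI iffI)
    fix S assume "S \<in> ?L"
    then obtain B where "S = (\<Inter>i<m + n. (T ^^ i) -` B i)" and B: "\<forall>i<m + n. B i \<in> \<alpha>"
      unfolding dynamical_join_alt by auto
    then have S: "S = (\<Inter>i<m. (T ^^ i) -` B i) \<inter> (T ^^ m) -` (\<Inter>i<n. (T ^^ i) -` B (m + i))"
      by (simp only: split)
    have "(\<Inter>i<m. (T ^^ i) -` B i) \<in> dynamical_join T m \<alpha>"
      unfolding dynamical_join_alt using B by auto
    moreover have "(\<Inter>i<n. (T ^^ i) -` B (m + i)) \<in> dynamical_join T n \<alpha>"
      unfolding dynamical_join_alt using B by (intro CollectI exI[of _ "\<lambda>i. B (m + i)"]) auto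
    ultimately show "S \<in> ?R" using S by blast
  next
    fix S assume "S \<in> ?R"
    then obtain B C where S: "S = (\<Inter>i<m. (T ^^ i) -` B i) \<inter> (T ^^ m) -` (\<Inter>i<n. (T ^^ i) -` C i)"
      and BC: "\<forall>i<m. B i \<in> \<alpha>" "\<forall>i<n. C i \<in> \<alpha>"
      unfolding dynamical_join_alt by auto
    define D where "D i = (if i < m then B i else C (i - m))" for i
    have "S = (\<Inter>i<m + n. (T ^^ i) -` D i)"
      unfolding split S by (simp add: D_def)
    moreover have "\<forall>i<m + n. D i \<in> \<alpha>" using BC by (auto simp: D_def)
    ultimately show "S \<in> ?L" unfolding dynamical_join_alt by auto
  qed
qed

lemma borel_measurable_funpow:
  fixes T :: "'a::topological_space \<Rightarrow> 'a"
  assumes "T \<in> borel_measurable borel"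
  shows "(T ^^ n) \<in> borel_measurable borel"
proof (induction n)
  case (Suc n)
  show ?case
    unfolding funpow.simps using Suc assms by (rule measurable_comp)
qed (simp add: id_def)

lemma finite_borel_partition_dynamical_join:
  assumes "finite_borel_partition \<alpha>" "T \<in> borel_measurable borel"
  shows "finite_borel_partition (dynamical_join T n \<alpha>)"
proof (induction n)
  case 0
  show ?case by (auto simp: partition_join_def finite_borel_partition_def)
next
  case (Suc n)
  have "dynamical_join T 1 \<alpha> = \<alpha>"
    by (auto simp: dynamical_join_alt lessThan_Suc intro!: exI[of _ "\<lambda>_. _"])
  then have "dynamical_join T (Suc n) \<alpha> =
      (\<lambda>(A, B). A \<inter> B) ` (dynamical_join T n \<alpha> \<times> (-`) (T ^^ n) ` \<alpha>)"
    using dynamical_join_add[of n 1 T \<alpha>] by simp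
  then show ?case
    using Suc assms borel_measurable_funpow[OF assms(2), where n = n]
    by (simp add: finite_borel_partition_refinement finite_borel_partition_vimage)
qed

lemma measure_vimage_funpow:
  assumes "invariant_measure T \<mu>" "T \<in> borel_measurable borel" "B \<in> sets borel"
  shows "measure \<mu> ((T ^^ n) -` B) = measure \<mu> B"
proof (induction n)
  case (Suc n)
  have "(T ^^ n) -` B \<in> sets borel"
    using borel_measurable_funpow[OF assms(2)] assms(3) by (rule measurable_sets_borel)
  then have "measure \<mu> (T -` ((T ^^ n) -` B)) = measure \<mu> ((T ^^ n) -` B)"
    using assms(1) by (simp add: invariant_measure_def)
  moreover have "T -` ((T ^^ n) -` B) = (T ^^ Suc n) -` B"
    by (simp add: funpow_Suc_right vimage_comp del: funpow.simps)
  ultimately show ?case using Suc by (simp only:)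
qed simp

lemma convergent_dynamical_entropy:
  assumes "borel_probability \<mu>" "invariant_measure T \<mu>" "T \<in> borel_measurable borel"
    and "finite_borel_partition \<alpha>"
  shows "convergent (\<lambda>n. partition_entropy \<mu> (dynamical_join T n \<alpha>) / real n)"
proof (rule convergent_subadditive_quotient)
  interpret borel_prob_space \<mu> using assms(1) by (rule borel_prob_spaceI)
  show "0 \<le> partition_entropy \<mu> (dynamical_join T n \<alpha>)" for n
    by (rule partition_entropy_nonneg)
  fix m n
  have part: "finite_borel_partition (dynamical_join T k \<alpha>)" for k
    using finite_borel_partition_dynamical_join[OF assms(4,3)] .
  have "partition_entropy \<mu> (dynamical_join T (m + n) \<alpha>) \<le>
      partition_entropy \<mu> (dynamical_join T m \<alpha>) +
      partition_entropy \<mu> ((-`) (T ^^ m) ` dynamical_join T n \<alpha>)"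
    unfolding dynamical_join_add
    using assms part borel_measurable_funpow[OF assms(3)]
    by (intro partition_entropy_refinement_le finite_borel_partition_vimage)
       auto
  also have "partition_entropy \<mu> ((-`) (T ^^ m) ` dynamical_join T n \<alpha>) =
      partition_entropy \<mu> (dynamical_join T n \<alpha>)"
    using part measure_vimage_funpow[OF assms(2,3)] by (rule partition_entropy_vimage)
  finally show "partition_entropy \<mu> (dynamical_join T (m + n) \<alpha>) \<le>
      partition_entropy \<mu> (dynamical_join T m \<alpha>) + partition_entropy \<mu> (dynamical_join T n \<alpha>)" .
qed

section \<open>Consequences of compactness\<close>

lemma compact_UNIV_finite_net:
  fixes e :: real
  assumes "compact (UNIV :: 'a::metric_space set)" "e > 0"
  obtains C :: "'a::metric_space set" where "finite C" "(\<Union>c\<in>C. ball c e) = UNIV"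
proof -
  have cov: "UNIV \<subseteq> (\<Union>c\<in>(UNIV :: 'a set). ball c e)"
  proof
    fix x :: 'a
    have "x \<in> ball x e" using assms(2) by simp
    then show "x \<in> (\<Union>c\<in>UNIV. ball c e)" by (rule UN_I[of x, OF UNIV_I])
  qed
  obtain C :: "'a set" where "finite C" and C: "UNIV \<subseteq> (\<Union>c\<in>C. ball c e)"
    by (rule compactE_image[OF assms(1) open_ball cov])
  show thesis
    by (rule that[OF \<open>finite C\<close>]) (rule top.extremum_uniqueI[OF C])
qed

text \<open>Classifying points by the members of a finite cover by balls of radius \<open>e / 2\<close> in which they lie
  yields a partition; as every point lies in some ball, two points of one cell share a ball.\<close>

lemma ex_small_partition:
  assumes "compact (UNIV :: 'a::metric_space set)" "(e::real) > 0"
  obtains \<alpha> :: "'a::metric_space set set" where "finite_borel_partition \<alpha>"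
    "\<And>A x y. A \<in> \<alpha> \<Longrightarrow> x \<in> A \<Longrightarrow> y \<in> A \<Longrightarrow> dist x y < e"
proof -
  obtain C :: "'a set" where C: "finite C" "(\<Union>c\<in>C. ball c (e / 2)) = UNIV"
    using compact_UNIV_finite_net[OF assms(1), of "e / 2"] assms(2) by auto
  define cell where "cell F = {x. {c\<in>C. x \<in> ball c (e / 2)} = F}" for F
  have "finite_borel_partition (cell ` Pow C)"
    unfolding finite_borel_partition_def
  proof (intro conjI)
    show "cell ` Pow C \<subseteq> sets borel"
    proof clarify
      fix F assume "F \<subseteq> C"
      then have "x \<in> cell F \<longleftrightarrow> (\<forall>c\<in>C. x \<in> ball c (e / 2) \<longleftrightarrow> c \<in> F)" for x
        unfolding cell_def by blast
      then have "cell F = (\<Inter>c\<in>C. if c \<in> F then ball c (e / 2) else - ball c (e / 2))"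
        by (intro set_eqI) (simp only: INT_iff, auto split: if_splits)
      also have "\<dots> \<in> sets borel"
      proof (cases "C = {}")
        case False
        then show ?thesis by (intro sets.finite_INT C(1)) auto
      qed simp
      finally show "cell F \<in> sets borel" .
    qed
    have "F = F'" if "x \<in> cell F" "x \<in> cell F'" for x F F'
      using that by (simp only: cell_def mem_Collect_eq)
    then show "disjoint (cell ` Pow C)" unfolding disjoint_def by blast
    have "x \<in> cell {c\<in>C. x \<in> ball c (e / 2)}" for x by (simp only: cell_def mem_Collect_eq)
    moreover have "{c\<in>C. x \<in> ball c (e / 2)} \<in> Pow C" for x by blast
    ultimately show "\<Union>(cell ` Pow C) = UNIV"
      by (intro UNIV_eq_I[symmetric]) (rule UnionI[OF imageI])
  qed (use C in auto)
  moreover have "dist x y < e" if "A \<in> cell ` Pow C" "x \<in> A" "y \<in> A" for A x y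
  proof -
    obtain c where "c \<in> C" "x \<in> ball c (e / 2)" using C(2) by blast
    moreover from this have "y \<in> ball c (e / 2)" using that by (auto simp: cell_def)
    ultimately show ?thesis
      using dist_triangle_half_r[of c x e y] by (simp add: dist_commute)
  qed
  ultimately show thesis by (rule that)
qed

text \<open>For each \<open>k \<ge> 1\<close>, finitely many balls of radius \<open>1 / (2 * k)\<close> cover the points around which the
  ball of radius \<open>1 / k\<close> is null, and such a ball is null as soon as it contains one of these points.  So the
  complement of the support is a countable union of null sets.\<close>

lemma ex_full_measure_support:
  fixes \<mu> :: "'a::metric_space measure"
  assumes "compact (UNIV :: 'a set)" "borel_probability \<mu>"
  obtains S where "S \<in> sets borel" "measure \<mu> S = 1"
    "\<And>U x. open U \<Longrightarrow> x \<in> U \<Longrightarrow> measure \<mu> U = 0 \<Longrightarrow> x \<notin> S"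
proof -
  interpret borel_prob_space \<mu> using assms(2) by (rule borel_prob_spaceI)
  define r where "r k = inverse (real (Suc k)) / 2" for k
  have r: "r k > 0" for k by (simp add: r_def)
  have "\<exists>C::'a set. finite C \<and> (\<Union>c\<in>C. ball c (r k)) = UNIV" for k
    using compact_UNIV_finite_net[OF assms(1) r] by metis
  then obtain C :: "nat \<Rightarrow> 'a set"
    where C: "\<And>k. finite (C k)" "\<And>k. (\<Union>c\<in>C k. ball c (r k)) = UNIV"
    by metis
  define V where "V = (\<Union>k. \<Union>c\<in>{c \<in> C k. prob (ball c (r k)) = 0}. ball c (r k))"
  have "V \<in> null_sets \<mu>"
    unfolding V_def
    using C(1) by (intro null_sets_UN null_sets.finite_UN)
      (auto simp: null_sets_def emeasure_eq_measure)
  then have V: "V \<in> sets \<mu>" "prob V = 0"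
    by (auto simp: null_sets_def emeasure_eq_measure)
  show thesis
  proof (rule that[of "- V"])
    show "- V \<in> sets borel" using V by (simp add: borel_comp)
    show "prob (- V) = 1"
      using prob_compl[OF V(1)] V(2) by (simp add: Compl_eq_Diff_UNIV)
    fix U x assume U: "open U" "x \<in> U" "prob U = 0"
    then obtain e where e: "e > 0" "ball x e \<subseteq> U" by (meson openE)
    obtain k where k: "inverse (real (Suc k)) < e"
      using reals_Archimedean[OF e(1)] by blast
    obtain c where c: "c \<in> C k" "x \<in> ball c (r k)" using C(2) by blast
    have "ball c (r k) \<subseteq> ball x e"
    proof
      fix y assume "y \<in> ball c (r k)"
      then have "dist x y < 2 * r k"
        using c(2) dist_triangle[of x y c] by (simp add: dist_commute)
      also have "\<dots> < e" using k by (simp add: r_def)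
      finally show "y \<in> ball x e" by simp
    qed
    then have "prob (ball c (r k)) \<le> prob U"
      using e U by (intro finite_measure_mono) auto
    then have "prob (ball c (r k)) = 0" using U(3) by (simp add: measure_le_0_iff)
    then have "x \<in> V" using c by (auto simp: V_def)
    then show "x \<notin> - V" by simp
  qed
qed

section \<open>Covering numbers of expanding maps\<close>

lemma expansion_along_orbit:
  fixes T :: "'a::metric_space \<Rightarrow> 'a"
  assumes expand: "\<And>x y. y \<in> S \<Longrightarrow> dist x y < e \<Longrightarrow> exp a * dist x y \<le> dist (T x) (T y)"
    and close: "\<And>i. i \<le> k \<Longrightarrow> dist ((T ^^ i) x) ((T ^^ i) y) < e"
    and S: "\<And>i. i \<le> k \<Longrightarrow> (T ^^ i) y \<in> S"
  shows "dist x y < e * exp (- a * real k)"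
proof -
  have "exp (a * real i) * dist x y \<le> dist ((T ^^ i) x) ((T ^^ i) y)" if "i \<le> k" for i
    using that
  proof (induction i)
    case (Suc i)
    have "exp (a * real (Suc i)) * dist x y = exp a * (exp (a * real i) * dist x y)"
      by (simp add: exp_add algebra_simps)
    also have "\<dots> \<le> exp a * dist ((T ^^ i) x) ((T ^^ i) y)"
      using Suc by (intro mult_left_mono) auto
    also have "\<dots> \<le> dist (T ((T ^^ i) x)) (T ((T ^^ i) y))"
      using Suc.prems by (intro expand S close) auto
    finally show ?case by simp
  qed simp
  then have "exp (a * real k) * dist x y < e"
    using close[of k] by (meson le_less_trans order_refl)
  then show ?thesis by (simp add: exp_minus field_simps)
qed

text \<open>The set covered consists of the large atoms, intersected with the full-measure set of points
  whose first \<open>k + 1\<close> iterates lie in \<open>S\<close>; each atom needs one ball, centred at any of its points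
  in that set.\<close>

lemma covering_number_le:
  fixes T :: "'a::metric_space \<Rightarrow> 'a" and \<mu> :: "'a measure"
  assumes \<mu>: "borel_probability \<mu>" "invariant_measure T \<mu>" and T: "T \<in> borel_measurable borel"
    and S: "S \<in> sets borel" "measure \<mu> S = 1"
    and expand: "\<And>x y. y \<in> S \<Longrightarrow> dist x y < e \<Longrightarrow> exp a * dist x y \<le> dist (T x) (T y)"
    and \<alpha>: "finite_borel_partition \<alpha>"
      "\<And>A x y. A \<in> \<alpha> \<Longrightarrow> x \<in> A \<Longrightarrow> y \<in> A \<Longrightarrow> dist x y < e"
    and \<beta>: "e * exp (- a * real k) \<le> \<beta>" and t: "t > 0"
    and ent: "partition_entropy \<mu> (dynamical_join T (Suc k) \<alpha>) \<le> \<delta> * t"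
  shows "real (covering_number \<mu> \<beta> \<delta>) \<le> exp t"
proof -
  interpret borel_prob_space \<mu> using \<mu>(1) by (rule borel_prob_spaceI)
  define P where "P = dynamical_join T (Suc k) \<alpha>"
  have P: "finite_borel_partition P"
    unfolding P_def using finite_borel_partition_dynamical_join[OF \<alpha>(1) T] .
  define Q where "Q = {A\<in>P. exp (- t) \<le> prob A}"
  have Q: "finite Q" "\<Union>Q \<in> sets \<mu>"
    using P by (auto simp: Q_def finite_borel_partition_def intro!: sets.finite_Union)
  define G where "G = (\<Inter>i\<le>k. (T ^^ i) -` S)"
  have T_meas: "(T ^^ i) -` S \<in> sets \<mu>" for i
    using measurable_sets_borel[OF borel_measurable_funpow[OF T] S(1)] by simp
  have G_meas: "G \<in> sets \<mu>" unfolding G_def using T_meas by (intro sets.finite_INT) auto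
  have "prob ((T ^^ i) -` S) = 1" for i
    using measure_vimage_funpow[OF \<mu>(2) T S(1)] S(2) by simp
  then have "AE x in \<mu>. \<forall>i\<in>{..k}. x \<in> (T ^^ i) -` S"
    using T_meas by (intro AE_finite_allI) (auto simp: prob_eq_1)
  then have "AE x in \<mu>. x \<in> G" by (auto simp: G_def elim!: eventually_mono)
  then have "prob (\<Union>Q \<inter> G) = prob (\<Union>Q)"
    using Q G_meas by (intro finite_measure_eq_AE) auto
  moreover have "1 - \<delta> \<le> 1 - partition_entropy \<mu> P / t"
    using ent t by (simp add: P_def field_simps)
  ultimately have mass: "1 - \<delta> \<le> prob (\<Union>Q \<inter> G)"
    using large_atoms(2)[OF P t] by (simp add: Q_def)
  \<comment> \<open>An atom that misses \<open>G\<close> contributes an arbitrary centre, which costs nothing.\<close>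
  define c where "c A = (SOME y. y \<in> A \<inter> G)" for A
  have cover: "\<Union>Q \<inter> G \<subseteq> (\<Union>z\<in>c ` Q. ball z \<beta>)"
  proof
    fix x assume "x \<in> \<Union>Q \<inter> G"
    then obtain A where A: "A \<in> Q" "x \<in> A" "x \<in> G" by blast
    then have cA: "c A \<in> A" "c A \<in> G"
      using someI[of "\<lambda>y. y \<in> A \<inter> G" x] by (auto simp: c_def)
    obtain B where B: "A = (\<Inter>i<Suc k. (T ^^ i) -` B i)" "\<forall>i<Suc k. B i \<in> \<alpha>"
      using A(1) unfolding Q_def P_def dynamical_join_alt by auto
    have "dist ((T ^^ i) (c A)) ((T ^^ i) x) < e" if "i \<le> k" for i
      using that B A(2) cA(1) by (intro \<alpha>(2)[of "B i"]) auto
    moreover have "(T ^^ i) x \<in> S" if "i \<le> k" for i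
      using that A(3) by (auto simp: G_def)
    ultimately have "dist (c A) x < e * exp (- a * real k)"
      using expand by (intro expansion_along_orbit[where T = T and S = S]) auto
    then show "x \<in> (\<Union>z\<in>c ` Q. ball z \<beta>)" using A(1) \<beta> by fastforce
  qed
  have "covering_number \<mu> \<beta> \<delta> \<le> card (c ` Q)"
    unfolding covering_number_def using Q G_meas mass cover
    by (intro Least_le exI[of _ "c ` Q"] exI[of _ "\<Union>Q \<inter> G"]) auto
  also have "\<dots> \<le> card Q" using Q(1) by (rule card_image_le)
  finally show ?thesis
    using large_atoms(1)[OF P t] by (simp add: Q_def)
qed

text \<open>Scale \<open>\<beta>\<close> is reached after about \<open>k = - ln \<beta> / a\<close> steps, so entropy growth at rate below \<open>s\<close> gives
  the exponent \<open>s * k\<close> for the covering number, that is \<open>s / a\<close> after division by \<open>- ln \<beta>\<close>.  As the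
  quotients are also nonnegative, the upper limit vanishes for every \<open>\<delta> > 0\<close>, and therefore the
  limit as \<open>\<delta>\<close> tends to \<open>0\<close> exists and is \<open>0\<close>.\<close>

lemma upper_capacity_eq_0:
  fixes T :: "'a::metric_space \<Rightarrow> 'a" and \<mu> :: "'a measure"
  assumes \<mu>: "borel_probability \<mu>" "invariant_measure T \<mu>" and T: "T \<in> borel_measurable borel"
    and S: "S \<in> sets borel" "measure \<mu> S = 1"
    and expand: "\<And>x y. y \<in> S \<Longrightarrow> dist x y < e \<Longrightarrow> exp a * dist x y \<le> dist (T x) (T y)"
    and \<alpha>: "finite_borel_partition \<alpha>"
      "\<And>A x y. A \<in> \<alpha> \<Longrightarrow> x \<in> A \<Longrightarrow> y \<in> A \<Longrightarrow> dist x y < e"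
    and a: "a > 0" and e: "e > 0"
    and ent: "(\<lambda>n. partition_entropy \<mu> (dynamical_join T n \<alpha>) / real n) \<longlonglongrightarrow> 0"
  shows "upper_capacity \<mu> = 0"
proof -
  let ?f = "\<lambda>\<delta> \<beta>. ereal (ln (real (covering_number \<mu> \<beta> \<delta>)) / (- ln \<beta>))"
  have small: "eventually (\<lambda>\<beta>. ?f \<delta> \<beta> \<le> ereal \<eta>) (at_right 0)"
    if \<delta>: "\<delta> > 0" and \<eta>: "\<eta> > 0" for \<delta> \<eta> :: real
  proof -
    define s where "s = \<eta> * a / 2"
    have s: "s > 0" using \<eta> a by (simp add: s_def)
    have "eventually (\<lambda>n. partition_entropy \<mu> (dynamical_join T n \<alpha>) / real n < \<delta> * s) sequentially"
      using ent \<delta> s by (intro order_tendstoD) auto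
    then obtain K where
      K: "\<And>n. n \<ge> K \<Longrightarrow> partition_entropy \<mu> (dynamical_join T n \<alpha>) / real n < \<delta> * s"
      by (auto simp: eventually_sequentially)
    \<comment> \<open>The second bound forces at least \<open>K\<close> steps; the third makes \<open>ln e\<close> and the rounding of the
      number of steps cost no more than a factor \<open>2\<close>.\<close>
    define b where "b = min 1 (min (e * exp (- a * real K)) (exp (- 2 * a) / e))"
    have "b > 0" using e by (simp add: b_def)
    moreover have "?f \<delta> \<beta> \<le> ereal \<eta>" if \<beta>: "0 < \<beta>" "\<beta> < b" for \<beta>
    proof -
      have "\<beta> < 1" using \<beta> by (simp add: b_def)
      then have neg: "ln \<beta> < 0" using \<beta> by simp
      have "ln \<beta> \<le> ln (e * exp (- a * real K))"
        using \<beta> e by (intro ln_mono) (auto simp: b_def)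
      then have l1: "ln \<beta> \<le> ln e - a * real K" using e by (simp add: ln_mult)
      have "ln \<beta> \<le> ln (exp (- 2 * a) / e)"
        using \<beta> e by (intro ln_mono) (auto simp: b_def)
      then have l2: "ln \<beta> \<le> - 2 * a - ln e" using e by (simp add: ln_div)
      define v where "v = (ln e - ln \<beta>) / a"
      have v: "v \<ge> real K" using l1 a by (simp add: v_def field_simps)
      define k where "k = nat \<lceil>v\<rceil>"
      have k: "v \<le> real k" "real k < v + 1" "K \<le> k"
        using v unfolding k_def by linarith+
      have "e * exp (- a * real k) \<le> e * exp (- a * v)"
        using k a e by simp
      also have "\<dots> = \<beta>"
        using a e \<beta> by (simp add: v_def exp_diff)
      finally have scale: "e * exp (- a * real k) \<le> \<beta>" .
      define t where "t = s * real (Suc k)"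
      have t: "t > 0" using s by (simp add: t_def)
      have "partition_entropy \<mu> (dynamical_join T (Suc k) \<alpha>) / real (Suc k) < \<delta> * s"
        using k by (intro K) simp
      then have ent: "partition_entropy \<mu> (dynamical_join T (Suc k) \<alpha>) \<le> \<delta> * t"
        by (simp add: t_def field_simps)
      have N: "real (covering_number \<mu> \<beta> \<delta>) \<le> exp t"
        by (rule covering_number_le[OF \<mu> T S _ \<alpha>(1) _ scale t ent]) (fact expand \<alpha>(2))+
      have "ln (real (covering_number \<mu> \<beta> \<delta>)) \<le> t"
      proof (cases "covering_number \<mu> \<beta> \<delta> = 0")
        case False
        then have "ln (real (covering_number \<mu> \<beta> \<delta>)) \<le> ln (exp t)"
          using N by (intro ln_mono) auto
        then show ?thesis by simp
      qed (use t in simp)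
      also have "t \<le> s * (v + 2)"
        unfolding t_def using k s by (intro mult_left_mono) auto
      also have "\<dots> = \<eta> / 2 * (ln e - ln \<beta> + 2 * a)"
        using a by (simp add: s_def v_def field_simps)
      also have "\<dots> \<le> \<eta> / 2 * (2 * (- ln \<beta>))"
        using l2 \<eta> by (intro mult_left_mono) auto
      finally show ?thesis using neg by (simp add: field_simps)
    qed
    ultimately show ?thesis
      unfolding eventually_at_right_field by blast
  qed
  have zero: "Limsup (at_right 0) (?f \<delta>) = 0" if "\<delta> > 0" for \<delta> :: real
  proof (rule antisym)
    show "Limsup (at_right 0) (?f \<delta>) \<le> 0"
    proof (rule ereal_le_epsilon2)
      fix \<eta> :: real assume "\<eta> > 0"
      then show "Limsup (at_right 0) (?f \<delta>) \<le> 0 + ereal \<eta>"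
        using small[OF that] by (simp add: Limsup_bounded)
    qed
    have "eventually (\<lambda>\<beta>::real. 0 \<le> ?f \<delta> \<beta>) (at_right 0)"
      unfolding eventually_at_right_field
    proof (intro exI[of _ 1] conjI allI impI)
      fix \<beta> :: real assume "0 < \<beta>" "\<beta> < 1"
      then have "ln \<beta> < 0" by simp
      moreover have "0 \<le> ln (real n)" for n :: nat by (cases "n = 0") auto
      ultimately show "0 \<le> ?f \<delta> \<beta>" by (simp add: divide_nonneg_neg)
    qed simp
    then show "0 \<le> Limsup (at_right 0) (?f \<delta>)"
      by (intro le_Limsup) simp_all
  qed
  have "((\<lambda>\<delta>::real. Limsup (at_right 0) (?f \<delta>)) \<longlongrightarrow> 0) (at_right 0)"
    using eventually_at_right_less[of "0::real"]
    by (intro tendsto_eventually, elim eventually_mono) (rule zero)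
  then show ?thesis
    unfolding upper_capacity_def by (intro tendsto_Lim) simp_all
qed

theorem mainTheorem6:
  fixes T :: "'a::metric_space \<Rightarrow> 'a" and \<mu> :: "'a measure"
  assumes "compact (UNIV :: 'a set)"
    and "continuous_on UNIV T"
    and "borel_probability \<mu>"
    and "invariant_measure T \<mu>"
    and "ergodic_measure T \<mu>"
    and "expansion_exponent \<mu> T > 0"
    and "upper_capacity \<mu> > 0"
  shows "ks_entropy \<mu> T > 0"
proof (rule ccontr)
  assume zero: "\<not> ks_entropy \<mu> T > 0"
  interpret borel_prob_space \<mu> using assms(3) by (rule borel_prob_spaceI)
  have T: "T \<in> borel_measurable borel"
    using assms(2) by (rule borel_measurable_continuous_onI)
  obtain a e :: real where a: "a > 0" and e: "e > 0"
    and null: "\<And>x. measure \<mu> {y \<in> ball x e. dist (T x) (T y) < exp a * dist x y} = 0"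
    using assms(6) unfolding expansion_exponent_def less_Sup_iff by auto
  obtain S where S: "S \<in> sets borel" "measure \<mu> S = 1"
    and supp: "\<And>U x. open U \<Longrightarrow> x \<in> U \<Longrightarrow> measure \<mu> U = 0 \<Longrightarrow> x \<notin> S"
    using ex_full_measure_support[OF assms(1,3)] by blast
  have expand: "exp a * dist x y \<le> dist (T x) (T y)" if "y \<in> S" "dist x y < e" for x y
  proof (rule ccontr)
    assume "\<not> exp a * dist x y \<le> dist (T x) (T y)"
    moreover have "open {y \<in> ball x e. dist (T x) (T y) < exp a * dist x y}"
      unfolding mem_ball using assms(2)
      by (intro open_Collect_conj open_Collect_less continuous_intros)
    ultimately show False using supp[OF _ _ null, of x y] that by auto
  qed
  obtain \<alpha> :: "'a set set" where \<alpha>: "finite_borel_partition \<alpha>"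
    "\<And>A x y. A \<in> \<alpha> \<Longrightarrow> x \<in> A \<Longrightarrow> y \<in> A \<Longrightarrow> dist x y < e"
    using ex_small_partition[OF assms(1) e] by blast
  let ?h = "\<lambda>n. partition_entropy \<mu> (dynamical_join T n \<alpha>) / real n"
  have lim: "?h \<longlonglongrightarrow> lim ?h"
    using convergent_dynamical_entropy[OF assms(3,4) T \<alpha>(1)] by (simp add: convergent_LIMSEQ_iff)
  have "ereal (lim ?h) \<le> ks_entropy \<mu> T"
    unfolding ks_entropy_def using \<alpha>(1) by (intro SUP_upper) simp
  then have "ereal (lim ?h) \<le> 0" using zero by (meson linorder_not_less order_trans)
  then have "lim ?h \<le> 0" by simp
  moreover have "0 \<le> lim ?h"
    using lim by (rule LIMSEQ_le_const) (auto simp: partition_entropy_nonneg)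
  ultimately have ent: "?h \<longlonglongrightarrow> 0" using lim by simp
  have "upper_capacity \<mu> = 0"
    by (rule upper_capacity_eq_0[OF assms(3,4) T S _ \<alpha>(1) _ a e ent]) (fact expand \<alpha>(2))+
  then show False using assms(7) by simp
qed

end
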